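(* Let $G$ be a graph with maximum degree $\Delta$. Then $\chi'_{ur}(G)\le 2\Delta+4$ if $\operatorname{mad}(G)<14/5$, and $\chi'_{ur}(G)\le 2\Delta+2$ if $\operatorname{mad}(G)<8/3$.
   Context: Graphs are finite, undirected and simple. The maximum average degree $\operatorname{mad}(G)$ is the maximum of the average degrees of the non-empty subgraphs of $G$. A matching $M$ of $G$ is a set of pairwise disjoint edges; $G_M$ denotes the subgraph of $G$ induced by the vertices covered by $M$. A matching $M$ of $G$ is uniquely restricted if $M$ is the unique perfect matching of $G_M$. A uniquely restricted edge coloring of $G$ is an assignment of colors to the edges of $G$ such that every color class is a uniquely restricted matching of $G$. The uniquely restricted chromatic index $\chi'_{ur}(G)$ is the minimum number of colors in a uniquely restricted edge coloring of $G$. *)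

theory Defs
  imports Complex_Main
begin

text \<open>
  A finite simple graph is given by its vertex set \<open>V\<close> and its set \<open>E\<close> of edges, which are
  two-element sets of vertices. The null graph is not excluded; there \<open>Max\<close> is applied to the
  empty set in \<open>max_degree\<close> and \<open>mad\<close>, so that both values are unspecified.
\<close>

definition simple_graph :: "'a set \<Rightarrow> 'a set set \<Rightarrow> bool" where
  "simple_graph V E \<longleftrightarrow> finite V \<and> (\<forall>e\<in>E. e \<subseteq> V \<and> card e = 2)"

definition degree :: "'a set set \<Rightarrow> 'a \<Rightarrow> nat" where
  "degree E v = card {e \<in> E. v \<in> e}"

definition max_degree :: "'a set \<Rightarrow> 'a set set \<Rightarrow> nat" where
  "max_degree V E = Max (degree E ` V)"

definition average_degree :: "'a set \<Rightarrow> 'a set set \<Rightarrow> real" where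
  "average_degree V E = real (\<Sum>v\<in>V. degree E v) / real (card V)"

definition subgraph :: "'a set \<Rightarrow> 'a set set \<Rightarrow> 'a set \<Rightarrow> 'a set set \<Rightarrow> bool" where
  "subgraph W F V E \<longleftrightarrow> simple_graph W F \<and> W \<subseteq> V \<and> F \<subseteq> E"

definition mad :: "'a set \<Rightarrow> 'a set set \<Rightarrow> real" where
  "mad V E = Max {average_degree W F | W F. subgraph W F V E \<and> W \<noteq> {}}"

definition matching :: "'a set set \<Rightarrow> 'a set set \<Rightarrow> bool" where
  "matching E M \<longleftrightarrow> M \<subseteq> E \<and> pairwise disjnt M"

definition perfect_matching :: "'a set \<Rightarrow> 'a set set \<Rightarrow> 'a set set \<Rightarrow> bool" where
  "perfect_matching V E M \<longleftrightarrow> matching E M \<and> \<Union>M = V"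

definition induced_edges :: "'a set set \<Rightarrow> 'a set \<Rightarrow> 'a set set" where
  "induced_edges E W = {e \<in> E. e \<subseteq> W}"

text \<open>
  The vertices covered by \<open>M\<close> are \<open>\<Union>M\<close>, so the subgraph induced by them
  has vertex set \<open>\<Union>M\<close> and edge set \<open>induced_edges E (\<Union>M)\<close>.
\<close>

definition uniquely_restricted :: "'a set set \<Rightarrow> 'a set set \<Rightarrow> bool" where
  "uniquely_restricted E M \<longleftrightarrow> matching E M \<and>
     perfect_matching (\<Union>M) (induced_edges E (\<Union>M)) M \<and>
     (\<forall>N. perfect_matching (\<Union>M) (induced_edges E (\<Union>M)) N \<longrightarrow> N = M)"

definition ur_edge_coloring :: "'a set set \<Rightarrow> ('a set \<Rightarrow> 'c) \<Rightarrow> bool" where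
  "ur_edge_coloring E c \<longleftrightarrow> (\<forall>k \<in> c ` E. uniquely_restricted E {e \<in> E. c e = k})"

text \<open>Natural numbers suffice as colors since \<open>E\<close> is finite.\<close>

definition ur_chromatic_index :: "'a set set \<Rightarrow> nat" where
  "ur_chromatic_index E = (LEAST k. \<exists>c :: 'a set \<Rightarrow> nat. ur_edge_coloring E c \<and> card (c ` E) = k)"

text \<open>On non-null graphs the maxima, and on all graphs the minimum, are attained.\<close>

lemma simple_graph_finite_edges: "simple_graph V E \<Longrightarrow> finite E"
  unfolding simple_graph_def by (meson PowI finite_Pow_iff finite_subset subsetI)

lemma max_degree_attained:
  assumes "simple_graph V E" "V \<noteq> {}"
  shows "max_degree V E \<in> degree E ` V" "v \<in> V \<Longrightarrow> degree E v \<le> max_degree V E"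
  using assms unfolding max_degree_def simple_graph_def by (auto intro: Max_in)

lemma mad_attained:
  assumes "simple_graph V E" "V \<noteq> {}"
  shows "\<exists>W F. subgraph W F V E \<and> W \<noteq> {} \<and> mad V E = average_degree W F"
    and "subgraph W F V E \<Longrightarrow> W \<noteq> {} \<Longrightarrow> average_degree W F \<le> mad V E"
proof -
  let ?A = "{average_degree W F | W F. subgraph W F V E \<and> W \<noteq> {}}"
  have "?A \<subseteq> (\<lambda>(W, F). average_degree W F) ` (Pow V \<times> Pow E)"
    by (auto simp: subgraph_def)
  moreover have "finite (Pow V \<times> Pow E)"
    using assms simple_graph_finite_edges[OF assms(1)] by (simp add: simple_graph_def)
  ultimately have fin: "finite ?A"
    using finite_surj by blast
  have "subgraph V E V E"
    using assms by (simp add: subgraph_def)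
  then have "?A \<noteq> {}"
    using assms by blast
  with fin have "mad V E \<in> ?A"
    unfolding mad_def by (rule Max_in)
  then show "\<exists>W F. subgraph W F V E \<and> W \<noteq> {} \<and> mad V E = average_degree W F"
    by blast
  show "average_degree W F \<le> mad V E" if "subgraph W F V E" "W \<noteq> {}"
    unfolding mad_def using fin that by (blast intro: Max_ge)
qed

lemma uniquely_restricted_single_edge:
  assumes "simple_graph V E" "e \<in> E"
  shows "uniquely_restricted E {e}"
proof -
  have card2: "card f = 2" if "f \<in> E" for f
    using assms that by (simp add: simple_graph_def)
  have fine: "finite e"
    using card2[OF assms(2)] card.infinite by fastforce
  have "N = {e}" if N: "perfect_matching e (induced_edges E e) N" for N
  proof -
    have "f = e" if "f \<in> N" for f
    proof (rule card_subset_eq[OF fine])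
      have "f \<in> E \<and> f \<subseteq> e"
        using N that by (auto simp: perfect_matching_def matching_def induced_edges_def)
      then show "f \<subseteq> e" "card f = card e"
        using card2 assms(2) by simp_all
    qed
    moreover have "N \<noteq> {}"
      using N card2[OF assms(2)] by (auto simp: perfect_matching_def)
    ultimately show ?thesis
      by blast
  qed
  then show ?thesis
    using assms(2)
    by (auto simp: uniquely_restricted_def perfect_matching_def matching_def induced_edges_def)
qed

lemma ur_chromatic_index_attained:
  assumes "simple_graph V E"
  shows "\<exists>c :: 'a set \<Rightarrow> nat. ur_edge_coloring (E :: 'a set set) c \<and> card (c ` E) = ur_chromatic_index E"
proof -
  obtain c :: "'a set \<Rightarrow> nat" where c: "inj_on c E"
    using finite_imp_inj_to_nat_seg simple_graph_finite_edges[OF assms] by blast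
  have "{f \<in> E. c f = c e} = {e}" if "e \<in> E" for e
    using c that by (auto simp: inj_on_def)
  then have "ur_edge_coloring E c"
    using uniquely_restricted_single_edge[OF assms] by (simp add: ur_edge_coloring_def)
  then have "\<exists>k. \<exists>c :: 'a set \<Rightarrow> nat. ur_edge_coloring E c \<and> card (c ` E) = k"
    by blast
  then show ?thesis
    unfolding ur_chromatic_index_def by (rule LeastI_ex)
qed

end

theory Submission
  imports Defs
begin

text \<open>
  Maximum average degree below \<open>3\<close> forces every non-empty subgraph to have a vertex of degree at
  most \<open>2\<close>, that is, the graph is \<open>2\<close>-degenerate. For a \<open>d\<close>-degenerate graph of maximum degree
  \<open>\<Delta>\<close>, a greedy coloring uses at most \<open>d \<cdot> \<Delta>\<close> colors, which for \<open>d = 2\<close> is better than both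
  bounds of the theorem.

  The greedy step deletes a vertex \<open>v\<close> of degree at most \<open>d\<close>, colors the rest by induction, and
  gives every edge at \<open>v\<close> a color that appears on no other edge meeting a neighbor of \<open>v\<close>. At most
  \<open>d \<cdot> \<Delta>\<close> edges meet a neighbor of \<open>v\<close>, the edges at \<open>v\<close> included, so there are enough colors
  (lemma \<open>degenerate_ur_edge_coloring\<close>). The extension stays uniquely restricted (lemma
  \<open>ur_edge_coloring_add_vertex\<close>): a color class has two perfect matchings on its vertices only if
  there is a cycle that alternates between edges inside and outside the class. If such a cycle
  went through \<open>v\<close>, it would enter \<open>v\<close> by an edge of the class and leave it by another edge
  \<open>vx\<close>, and the class would then have an edge at \<open>x\<close>; but its color was kept away from \<open>x\<close>. So the
  cycle avoids \<open>v\<close> and already exists in the smaller graph.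
\<close>

lemma uniquely_restricted_iff:
  "uniquely_restricted E M \<longleftrightarrow> matching E M \<and> (\<forall>N. matching E N \<and> \<Union>N = \<Union>M \<longrightarrow> N = M)"
proof -
  have "perfect_matching (\<Union>M) (induced_edges E (\<Union>M)) N \<longleftrightarrow> matching E N \<and> \<Union>N = \<Union>M" for N
    by (auto simp: perfect_matching_def matching_def induced_edges_def)
  then show ?thesis
    by (auto simp: uniquely_restricted_def)
qed

lemma uniquely_restricted_color_class:
  assumes "simple_graph V E" "ur_edge_coloring E c"
  shows "uniquely_restricted E {e \<in> E. c e = k}"
proof (cases "k \<in> c ` E")
  case True
  then show ?thesis
    using assms(2) unfolding ur_edge_coloring_def by blast
next
  case False
  then have empty: "{e \<in> E. c e = k} = {}"
    by auto
  have "N = {}" if "N \<subseteq> E" "\<Union>N = {}" for N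
    using that assms(1) by (force simp: simple_graph_def)
  then show ?thesis
    unfolding empty uniquely_restricted_iff by (auto simp: matching_def)
qed

text \<open>
  Assumption \<open>new\<close> asks that an edge at \<open>v\<close> shares its color with no other edge touching the
  closed neighborhood of \<open>v\<close>. If \<open>e\<close> is the edge at \<open>v\<close> in some color class, then no
  neighbor of \<open>v\<close> outside \<open>e\<close> is covered by the class, so every matching covering the same vertices must
  match \<open>v\<close> by \<open>e\<close> as well; what remains of it lies in the graph without \<open>v\<close>.
\<close>

lemma ur_edge_coloring_add_vertex:
  assumes G: "simple_graph V E"
    and old: "ur_edge_coloring {e \<in> E. v \<notin> e} c"
    and new: "\<And>e f g. \<lbrakk>e \<in> E; v \<in> e; g \<in> E; v \<in> g; f \<in> E; f \<inter> g \<noteq> {}; c f = c e\<rbrakk> \<Longrightarrow> f = e"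
  shows "ur_edge_coloring E c"
  unfolding ur_edge_coloring_def
proof
  fix k
  define E' where "E' = {e \<in> E. v \<notin> e}"
  define M where "M = {e \<in> E. c e = k}"
  define M' where "M' = {e \<in> E'. c e = k}"
  have "simple_graph V E'"
    using G by (simp add: simple_graph_def E'_def)
  then have "uniquely_restricted E' M'"
    unfolding M'_def using old by (intro uniquely_restricted_color_class) (simp_all add: E'_def)
  then have M': "matching E' M'" "\<And>N. matching E' N \<Longrightarrow> \<Union>N = \<Union>M' \<Longrightarrow> N = M'"
    by (auto simp: uniquely_restricted_iff)
  have "matching E M \<and> (\<forall>N. matching E N \<and> \<Union>N = \<Union>M \<longrightarrow> N = M)"
  proof (cases "v \<in> \<Union>M")
    case False
    then have "M = M'"
      by (auto simp: M_def M'_def E'_def)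
    moreover have "matching E' N" if "matching E N" "\<Union>N = \<Union>M" for N
      using that False by (auto simp: matching_def E'_def)
    moreover have "matching E M'"
      using M'(1) by (auto simp: matching_def E'_def)
    ultimately show ?thesis
      using M'(2) by metis
  next
    case True
    then obtain e where e: "e \<in> E" "c e = k" "v \<in> e"
      by (auto simp: M_def)
    have class_near_v: "f = e" if "f \<in> M" "g \<in> E" "v \<in> g" "f \<inter> g \<noteq> {}" for f g
      using new[OF e(1,3) that(2,3) _ that(4)] that(1) e(2) by (simp add: M_def)
    have M: "M = insert e M'"
    proof
      show "M \<subseteq> insert e M'"
        using class_near_v[OF _ e(1,3)] e(3) by (auto simp: M_def M'_def E'_def)
      show "insert e M' \<subseteq> M"
        using e by (auto simp: M_def M'_def E'_def)
    qed
    have e_disjoint: "f \<inter> e = {}" if "f \<in> M'" for f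
      using class_near_v[OF _ e(1,3), of f] that M e(3) by (auto simp: M'_def E'_def)
    have "matching E M"
      using M'(1) e(1) e_disjoint unfolding M
      by (auto simp: matching_def E'_def pairwise_insert disjnt_def)
    moreover have "N = M" if N: "matching E N" "\<Union>N = \<Union>M" for N
    proof -
      obtain g where g: "g \<in> N" "v \<in> g" "g \<in> E"
        using True N by (auto simp: matching_def)
      have "card g = 2" "card e = 2"
        using G g(3) e(1) by (simp_all add: simple_graph_def)
      then obtain u where u: "g = {v, u}" "u \<noteq> v"
        using g(2) by (auto simp: card_2_iff)
      then obtain f where f: "f \<in> M" "u \<in> f"
        using N(2) g(1) by blast
      then have "u \<in> e"
        using class_near_v[of f g] g u by auto
      then have "g = e"
        using u e(3) \<open>card e = 2\<close> by (auto simp: card_2_iff)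
      then have "e \<in> N"
        using g by simp
      then have rest_disjoint: "f \<inter> e = {}" if "f \<in> N - {e}" for f
        using N(1) that by (auto simp: matching_def pairwise_def disjnt_def)
      have "matching E' (N - {e})"
        using N(1) rest_disjoint e(3) by (auto simp: matching_def E'_def pairwise_def)
      moreover have "\<Union>(N - {e}) = \<Union>N - e" "\<Union>M' = \<Union>M - e"
        using rest_disjoint e_disjoint M by auto
      ultimately have "N - {e} = M'"
        using M'(2) N(2) by simp
      then show ?thesis
        using M \<open>e \<in> N\<close> by auto
    qed
    ultimately show ?thesis
      by blast
  qed
  then show "uniquely_restricted E {e \<in> E. c e = k}"
    by (simp add: uniquely_restricted_iff M_def)
qed

lemma card_edges_near_vertex:
  assumes G: "simple_graph V E" and D: "\<And>u. u \<in> V \<Longrightarrow> degree E u \<le> D"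
  shows "card {f \<in> E. \<exists>g\<in>E. v \<in> g \<and> f \<inter> g \<noteq> {}} \<le> degree E v * D"
proof -
  define S where "S = {g \<in> E. v \<in> g}"
  have fin: "finite E"
    using simple_graph_finite_edges[OF G] .
  have "\<exists>u\<in>V. u \<in> g \<and> g \<subseteq> {v, u}" if "g \<in> S" for g
    using that G by (fastforce simp: S_def simple_graph_def card_2_iff)
  then obtain u where u: "\<And>g. g \<in> S \<Longrightarrow> u g \<in> V \<and> u g \<in> g \<and> g \<subseteq> {v, u g}"
    by metis
  \<comment> \<open>an edge meeting \<open>g\<close> only in \<open>v\<close> is itself an edge at \<open>v\<close>, so it is counted at its own
    other end\<close>
  have "{f \<in> E. \<exists>g\<in>E. v \<in> g \<and> f \<inter> g \<noteq> {}} \<subseteq> (\<Union>g\<in>S. {f \<in> E. u g \<in> f})"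
  proof
    fix f assume "f \<in> {f \<in> E. \<exists>g\<in>E. v \<in> g \<and> f \<inter> g \<noteq> {}}"
    then obtain g where g: "f \<in> E" "g \<in> S" "f \<inter> g \<noteq> {}"
      by (auto simp: S_def)
    show "f \<in> (\<Union>g\<in>S. {f \<in> E. u g \<in> f})"
    proof (cases "v \<in> f")
      case True
      then have "f \<in> S"
        using g by (simp add: S_def)
      then show ?thesis
        using u[of f] g(1) by blast
    next
      case False
      then show ?thesis
        using u[OF g(2)] g by blast
    qed
  qed
  then have "card {f \<in> E. \<exists>g\<in>E. v \<in> g \<and> f \<inter> g \<noteq> {}} \<le> card (\<Union>g\<in>S. {f \<in> E. u g \<in> f})"
    using fin by (intro card_mono) (auto simp: S_def)
  also have "\<dots> \<le> (\<Sum>g\<in>S. degree E (u g))"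
    unfolding degree_def using fin by (intro card_UN_le) (simp add: S_def)
  also have "\<dots> \<le> degree E v * D"
    using sum_bounded_above[of S "\<lambda>g. degree E (u g)" D] D u
    by (simp add: S_def degree_def)
  finally show ?thesis .
qed

text \<open>
  The bound \<open>D\<close> on the degrees is a parameter, since the induction removes vertices while the
  number of colors has to stay the same.
\<close>

lemma degenerate_ur_edge_coloring:
  assumes "simple_graph V E"
    and "\<And>v. v \<in> V \<Longrightarrow> degree E v \<le> D"
    and "\<And>W F. subgraph W F V E \<Longrightarrow> W \<noteq> {} \<Longrightarrow> \<exists>v\<in>W. degree F v \<le> d"
  shows "\<exists>c :: 'a set \<Rightarrow> nat. ur_edge_coloring (E :: 'a set set) c \<and> c ` E \<subseteq> {..<d * D}"
  using assms
proof (induction "card V" arbitrary: V E rule: less_induct)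
  case (less V E)
  note G = less.prems(1) and D = less.prems(2) and degenerate = less.prems(3)
  have fin: "finite V" "finite E"
    using G simple_graph_finite_edges by (auto simp: simple_graph_def)
  show ?case
  proof (cases "V = {}")
    case True
    then have "E = {}"
      using G by (auto simp: simple_graph_def)
    then show ?thesis
      by (simp add: ur_edge_coloring_def)
  next
    case False
    have "subgraph V E V E"
      using G by (simp add: subgraph_def)
    then obtain v where v: "v \<in> V" "degree E v \<le> d"
      using degenerate False by blast
    define E' where "E' = {e \<in> E. v \<notin> e}"
    have "\<exists>c :: 'a set \<Rightarrow> nat. ur_edge_coloring E' c \<and> c ` E' \<subseteq> {..<d * D}"
    proof (rule less.hyps)
      show "card (V - {v}) < card V"
        using fin v by (intro card_Diff1_less)
      show "simple_graph (V - {v}) E'"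
        using G by (auto simp: simple_graph_def E'_def)
      show "degree E' w \<le> D" if "w \<in> V - {v}" for w
      proof -
        have "degree E' w \<le> degree E w"
          unfolding degree_def E'_def using fin by (intro card_mono) auto
        then show ?thesis
          using D[of w] that by simp
      qed
      show "\<exists>w\<in>W. degree F w \<le> d" if "subgraph W F (V - {v}) E'" "W \<noteq> {}" for W F
        using that degenerate[of W F] by (auto simp: subgraph_def E'_def)
    qed
    then obtain c :: "'a set \<Rightarrow> nat" where c: "ur_edge_coloring E' c" "c ` E' \<subseteq> {..<d * D}"
      by blast
    define S where "S = {e \<in> E. v \<in> e}"
    define B where "B = {f \<in> E'. \<exists>g\<in>S. f \<inter> g \<noteq> {}}"
    have finSB: "finite S" "finite B"
      using fin by (auto simp: S_def B_def E'_def)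
    have "S \<union> B \<subseteq> {f \<in> E. \<exists>g\<in>E. v \<in> g \<and> f \<inter> g \<noteq> {}}"
      by (auto simp: S_def B_def E'_def)
    then have "card (S \<union> B) \<le> card {f \<in> E. \<exists>g\<in>E. v \<in> g \<and> f \<inter> g \<noteq> {}}"
      using fin by (intro card_mono) auto
    also have "\<dots> \<le> degree E v * D"
      using card_edges_near_vertex[OF G D] .
    also have "\<dots> \<le> d * D"
      using v by simp
    finally have "card S + card B \<le> d * D"
      using finSB by (subst (asm) card_Un_disjoint) (auto simp: S_def B_def E'_def)
    moreover have "d * D - card (c ` B) \<le> card ({..<d * D} - c ` B)"
      using diff_card_le_card_Diff[of "c ` B" "{..<d * D}"] finSB by simp
    moreover have "card (c ` B) \<le> card B"
      using finSB by (simp add: card_image_le)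
    ultimately have "card S \<le> card ({..<d * D} - c ` B)"
      by linarith
    then obtain h where h: "h ` S \<subseteq> {..<d * D} - c ` B" "inj_on h S"
      using card_le_inj[of S "{..<d * D} - c ` B"] finSB by auto
    define c' where "c' e = (if v \<in> e then h e else c e)" for e
    have "{e \<in> E'. c' e = k} = {e \<in> E'. c e = k}" "c' ` E' = c ` E'" for k
      by (auto simp: c'_def E'_def)
    then have old: "ur_edge_coloring E' c'"
      using c(1) by (simp add: ur_edge_coloring_def)
    have color_unique: "f = e"
      if "e \<in> E" "v \<in> e" "g \<in> E" "v \<in> g" "f \<in> E" "f \<inter> g \<noteq> {}" "c' f = c' e" for e f g
    proof (cases "v \<in> f")
      case True
      then show ?thesis
        using h(2) that by (auto simp: c'_def S_def inj_on_def)
    next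
      case False
      then have "f \<in> B" "e \<in> S"
        using that by (auto simp: B_def E'_def S_def)
      moreover have "c f = h e"
        using that False by (simp add: c'_def)
      ultimately show ?thesis
        using h(1) by (metis DiffD2 imageI subsetD)
    qed
    have "ur_edge_coloring E c'"
      using ur_edge_coloring_add_vertex[OF G old[unfolded E'_def]] color_unique .
    moreover have "c' ` E \<subseteq> {..<d * D}"
      using c(2) h(1) by (auto simp: c'_def E'_def S_def)
    ultimately show ?thesis
      by blast
  qed
qed

lemma mad_less_imp_degenerate:
  assumes "simple_graph V E" "mad V E < real d + 1" "subgraph W F V E" "W \<noteq> {}"
  shows "\<exists>v\<in>W. degree F v \<le> d"
proof (rule ccontr)
  assume "\<not> ?thesis"
  then have "card W * (d + 1) \<le> (\<Sum>v\<in>W. degree F v)"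
    using sum_bounded_below[of W "d + 1" "degree F"] by (auto simp: not_le Suc_le_eq)
  then have "real (card W * (d + 1)) \<le> real (\<Sum>v\<in>W. degree F v)"
    by (rule of_nat_mono)
  moreover have "card W > 0"
    using assms(3,4) by (simp add: subgraph_def simple_graph_def card_gt_0_iff)
  ultimately have "real d + 1 \<le> average_degree W F"
    by (simp add: average_degree_def field_simps)
  also have "\<dots> \<le> mad V E"
    using assms by (intro mad_attained(2)) (auto simp: subgraph_def)
  finally show False
    using assms(2) by simp
qed

lemma ur_chromatic_index_le:
  fixes c :: "'a set \<Rightarrow> nat"
  assumes "ur_edge_coloring E c" "c ` E \<subseteq> {..<k}"
  shows "ur_chromatic_index E \<le> k"
proof -
  have "ur_chromatic_index E \<le> card (c ` E)"
    unfolding ur_chromatic_index_def using assms(1) by (intro Least_le) blast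
  also have "\<dots> \<le> k"
    using card_mono[OF _ assms(2)] by simp
  finally show ?thesis .
qed

lemma ur_chromatic_index_mad_less_3:
  assumes G: "simple_graph V E" and "mad V E < 3"
  shows "ur_chromatic_index E \<le> 2 * max_degree V E"
proof -
  have "\<exists>v\<in>W. degree F v \<le> 2" if "subgraph W F V E" "W \<noteq> {}" for W F
    using mad_less_imp_degenerate[OF G, of 2] assms(2) that by simp
  moreover have "degree E v \<le> max_degree V E" if "v \<in> V" for v
    using max_degree_attained(2)[OF G] that by blast
  ultimately show ?thesis
    using degenerate_ur_edge_coloring[OF G] ur_chromatic_index_le by metis
qed

theorem corollary1p3:
  fixes V :: "'a set" and E :: "'a set set"
  assumes "simple_graph V E"
  shows "(mad V E < 14 / 5 \<longrightarrow> ur_chromatic_index E \<le> 2 * max_degree V E + 4) \<and>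
         (mad V E < 8 / 3 \<longrightarrow> ur_chromatic_index E \<le> 2 * max_degree V E + 2)"
  using ur_chromatic_index_mad_less_3[OF assms] by linarith

end
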